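(* Let $a_2 \geq 3$ be an integer. The pair $(2,a_2)$ is a best 2-term Egyptian underapproximation sequence of $\theta$ for all $\theta$ in the interval \[ J(2,a_2) = \left( \frac{1}{2} + \frac{1}{a_2},\ \frac{1}{2} + \frac{1}{a_2 - 1} \right]. \] Moreover, with $J(2,6) = \left(\frac{2}{3}, \frac{7}{10}\right]$, $J(2,12) = \left(\frac{7}{12}, \frac{13}{22}\right]$, $J(2,30) = \left(\frac{8}{15}, \frac{31}{58}\right]$: (i) for all $\theta \in J(2,6)$, the pairs $(2,6)$ and $(3,3)$ are best 2-term underapproximation sequences of $\theta$, and they are the only ones; (ii) for all $\theta \in J(2,12)$, the pairs $(2,12)$ and $(3,4)$ are best 2-term underapproximation sequences of $\theta$, and they are the only ones; (iii) for all $\theta \in J(2,30)$, the pairs $(2,30)$ and $(3,5)$ are best 2-term underapproximation sequences of $\theta$, and they are the only ones; (iv) for all $\theta \in (1/2, 1]$ with $\theta \notin J(2,6) \cup J(2,12) \cup J(2,30)$, the 2-term greedy underapproximation sequence $(a_1,a_2)$ of $\theta$ is the unique best 2-term underapproximation sequence of $\theta$.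
   Context: For $\theta \in (0,1]$, $U_2(\theta)$ is the set of pairs of integers $(x_1,x_2)$ with $2 \leq x_1 \leq x_2$ and $\frac{1}{x_1} + \frac{1}{x_2} < \theta$, and $u_2(\theta) = \sup\{\frac{1}{x_1}+\frac{1}{x_2} : (x_1,x_2) \in U_2(\theta)\}$. A pair $(x_1,x_2) \in U_2(\theta)$ is a best 2-term (Egyptian) underapproximation sequence of $\theta$ if $\frac{1}{x_1}+\frac{1}{x_2} = u_2(\theta)$; it is the unique best one if no other pair in $U_2(\theta)$ has this property. Let $G(\theta) = \lfloor 1/\theta\rfloor + 1$ (the unique integer $a\ge 2$ with $1/a<\theta\le 1/(a-1)$); the 2-term greedy underapproximation sequence of $\theta$ is $(a_1,a_2)$ with $a_1 = G(\theta)$, $a_2 = G(\theta - 1/a_1)$. For $\theta\in J(2,a_2)$ with $a_2\ge 3$, the 2-term greedy underapproximation sequence of $\theta$ is $(2,a_2)$. *)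

theory Defs
  imports Complex_Main
begin

definition egypt_sum :: "int \<times> int \<Rightarrow> real" where
  "egypt_sum p = 1 / real_of_int (fst p) + 1 / real_of_int (snd p)"

definition U2 :: "real \<Rightarrow> (int \<times> int) set" where
  "U2 \<theta> = {(x1, x2). 2 \<le> x1 \<and> x1 \<le> x2 \<and> egypt_sum (x1, x2) < \<theta>}"

text \<open>The supremum is that of a nonempty set bounded above by \<open>\<theta>\<close> whenever \<open>\<theta> > 0\<close>.\<close>

definition u2 :: "real \<Rightarrow> real" where
  "u2 \<theta> = Sup (egypt_sum ` U2 \<theta>)"

definition best_underapprox2 :: "real \<Rightarrow> int \<times> int \<Rightarrow> bool" where
  "best_underapprox2 \<theta> p \<longleftrightarrow> p \<in> U2 \<theta> \<and> egypt_sum p = u2 \<theta>"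

definition unique_best_underapprox2 :: "real \<Rightarrow> int \<times> int \<Rightarrow> bool" where
  "unique_best_underapprox2 \<theta> p \<longleftrightarrow>
     best_underapprox2 \<theta> p \<and> (\<forall>q. best_underapprox2 \<theta> q \<longrightarrow> q = p)"

definition G :: "real \<Rightarrow> int" where
  "G \<theta> = \<lfloor>1 / \<theta>\<rfloor> + 1"

definition greedy2 :: "real \<Rightarrow> int \<times> int" where
  "greedy2 \<theta> = (let a1 = G \<theta> in (a1, G (\<theta> - 1 / real_of_int a1)))"

text \<open>\<open>J2 a\<close> is the interval written $J(2,a)$, for integers $a \ge 3$.\<close>

definition J2 :: "int \<Rightarrow> real set" where
  "J2 a = {1 / 2 + 1 / real_of_int a <.. 1 / 2 + 1 / (real_of_int a - 1)}"

end

theory Submission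
  imports Defs
begin

text \<open>
  The only pairs with \<open>3 \<le> x1 \<le> x2\<close> whose sum exceeds \<open>1/2\<close> are \<open>(3, 3)\<close>, \<open>(3, 4)\<close> and \<open>(3, 5)\<close>, with
  sums \<open>1/2 + 1/6\<close>, \<open>1/2 + 1/12\<close> and \<open>1/2 + 1/30\<close>. Hence every pair whose sum exceeds \<open>1/2\<close> has a
  sum of the form \<open>1/2 + 1/b\<close> with \<open>b\<close> an integer, and the largest such value below
  \<open>\<theta> \<in> J(2, a)\<close> is the one with \<open>b = a\<close>.
\<close>

text \<open>A relation and not a function of \<open>b\<close>, because two pairs share the same sum
  when \<open>b\<close> is 6, 12 or 30; these ties are the exceptional intervals.\<close>

definition half_excess_pair :: "int \<Rightarrow> int \<times> int \<Rightarrow> bool" where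
  "half_excess_pair b p \<longleftrightarrow>
     p = (2, b) \<or> (b = 6 \<and> p = (3, 3)) \<or> (b = 12 \<and> p = (3, 4)) \<or> (b = 30 \<and> p = (3, 5))"

lemma egypt_sum_half_excess_pair:
  assumes "half_excess_pair b p"
  shows "egypt_sum p = 1 / 2 + 1 / real_of_int b"
  using assms by (auto simp: half_excess_pair_def egypt_sum_def)

text \<open>If x = 3 and y \<ge> 6 the sum is at most 1/3 + 1/6, and if x \<ge> 4 it is at most 1/4
  + 1/4; neither exceeds 1/2. The bound on \<open>b\<close> is 2 rather than 3 because the pair (2,
  2) also occurs.\<close>

lemma egypt_sum_gt_half_cases:
  assumes "2 \<le> x" "x \<le> y" "egypt_sum (x, y) > 1 / 2"
  obtains b where "b \<ge> 2" "half_excess_pair b (x, y)"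
proof -
  consider "x = 2" | "x = 3" "y < 6" | "x = 3" "y \<ge> 6" | "x \<ge> 4"
    using assms(1) by linarith
  then show thesis
  proof cases
    case 1
    then show ?thesis using assms that[of y] by (simp add: half_excess_pair_def)
  next
    case 2
    then consider "y = 3" | "y = 4" | "y = 5" using assms(2) by linarith
    then show ?thesis
      using 2 that[of 6] that[of 12] that[of 30] by cases (simp_all add: half_excess_pair_def)
  next
    case 3
    then have "1 / real_of_int y \<le> 1 / 6" by (intro divide_left_mono) auto
    moreover have "egypt_sum (x, y) = 1 / 3 + 1 / real_of_int y"
      using 3 by (simp add: egypt_sum_def)
    ultimately show ?thesis using assms(3) by linarith
  next
    case 4
    then have "1 / real_of_int x \<le> 1 / 4" by (intro divide_left_mono) auto
    moreover have "1 / real_of_int y \<le> 1 / 4" using 4 assms(2) by (intro divide_left_mono) auto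
    ultimately show ?thesis using assms(3) by (simp add: egypt_sum_def)
  qed
qed

lemma half_excess_pair_in_U2:
  assumes "a \<ge> 3" "\<theta> \<in> J2 a" "half_excess_pair a p"
  shows "p \<in> U2 \<theta>"
proof -
  have "egypt_sum p < \<theta>"
    using assms(2) egypt_sum_half_excess_pair[OF assms(3)] by (simp add: J2_def)
  then show ?thesis
    using assms(1,3) by (auto simp: U2_def half_excess_pair_def)
qed

text \<open>Consecutive values 1/2 + 1/b leave no room for a sum strictly between 1/2 + 1/a and
  \<theta>. The second alternative is strict so that it excludes ties as well as larger
  sums.\<close>

lemma U2_J2_cases:
  assumes a: "a \<ge> 3" and \<theta>: "\<theta> \<in> J2 a" and p: "p \<in> U2 \<theta>"
  shows "half_excess_pair a p \<or> egypt_sum p < 1 / 2 + 1 / real_of_int a"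
proof (cases "egypt_sum p > 1 / 2")
  case False
  moreover have "0 < 1 / real_of_int a" using a by simp
  ultimately show ?thesis by linarith
next
  case True
  obtain x y where xy: "p = (x, y)" "2 \<le> x" "x \<le> y" "egypt_sum p < \<theta>"
    using p by (auto simp: U2_def)
  then obtain b where b: "b \<ge> 2" "half_excess_pair b p"
    using True egypt_sum_gt_half_cases by blast
  \<comment> \<open>Although \<open>J2 a\<close> contains its upper end, the sum is strictly below
    \<theta>, so this inequality is strict and integrality gives b \<ge> a.\<close>
  then have "1 / real_of_int b < 1 / (real_of_int a - 1)"
    using xy(4) \<theta> by (simp add: egypt_sum_half_excess_pair J2_def)
  then have "a - 1 < b"
    using a b(1) by (simp add: field_simps)
  then consider "b = a" | "a < b" by linarith
  then show ?thesis
  proof cases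
    case 1
    then show ?thesis using b by simp
  next
    case 2
    then have "1 / real_of_int b < 1 / real_of_int a"
      using a by (intro divide_strict_left_mono) auto
    then show ?thesis using b by (simp add: egypt_sum_half_excess_pair)
  qed
qed

text \<open>The pair (2, a) attains the bound of \<open>U2_J2_cases\<close>, so the supremum is a
  maximum, and the strict alternative there rules out every other pair.\<close>

lemma best_underapprox2_J2_iff:
  assumes "a \<ge> 3" "\<theta> \<in> J2 a"
  shows "best_underapprox2 \<theta> p \<longleftrightarrow> half_excess_pair a p"
proof -
  have "u2 \<theta> = 1 / 2 + 1 / real_of_int a"
    unfolding u2_def
  proof (rule cSup_eq_maximum)
    have "half_excess_pair a (2, a)" by (simp add: half_excess_pair_def)
    then show "1 / 2 + 1 / real_of_int a \<in> egypt_sum ` U2 \<theta>"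
      using half_excess_pair_in_U2[OF assms] egypt_sum_half_excess_pair by (metis image_eqI)
  next
    fix s assume "s \<in> egypt_sum ` U2 \<theta>"
    then show "s \<le> 1 / 2 + 1 / real_of_int a"
      using U2_J2_cases[OF assms] egypt_sum_half_excess_pair by fastforce
  qed
  then show ?thesis
    using half_excess_pair_in_U2[OF assms] U2_J2_cases[OF assms] egypt_sum_half_excess_pair
    by (fastforce simp: best_underapprox2_def)
qed

text \<open>The intervals J(2, a) with a \<ge> 3 cover (1/2, 1], and the greedy choice finds the one
  containing \<theta>: membership in \<open>J2 a\<close> says exactly that 1/a < \<theta> - 1/2
  \<le> 1/(a - 1).\<close>

lemma greedy2_J2:
  assumes "1 / 2 < \<theta>" "\<theta> \<le> 1"
  obtains a where "a \<ge> 3" "\<theta> \<in> J2 a" "greedy2 \<theta> = (2, a)"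
proof
  define t where "t = \<theta> - 1 / 2"
  have t: "0 < t" "t \<le> 1 / 2" using assms by (auto simp: t_def)
  \<comment> \<open>The first greedy term is thus 1/2, with remainder \<open>t\<close>.\<close>
  have "\<lfloor>1 / \<theta>\<rfloor> = 1" using assms by (simp add: floor_eq_iff field_simps)
  then show "greedy2 \<theta> = (2, G t)" by (simp add: greedy2_def G_def t_def)
  have "2 \<le> 1 / t" using t by (simp add: field_simps)
  then have floor_ge: "2 \<le> \<lfloor>1 / t\<rfloor>" by (simp add: le_floor_iff)
  then show "G t \<ge> 3" by (simp add: G_def)
  define n where "n = real_of_int \<lfloor>1 / t\<rfloor>"
  have "0 < n" using floor_ge by (simp add: n_def)
  \<comment> \<open>As n = \<open>G t\<close> - 1, taking reciprocals turns the floor bounds into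
    the two ends of \<open>J2 (G t)\<close>.\<close>
  moreover have "1 / t < n + 1" "n \<le> 1 / t" unfolding n_def by linarith+
  ultimately have "1 / (n + 1) < t" "t \<le> 1 / n"
    using t by (simp_all add: field_simps)
  then show "\<theta> \<in> J2 (G t)" by (simp add: J2_def G_def t_def n_def)
qed

theorem theorem7p1:
  shows "(\<forall>a2::int. a2 \<ge> 3 \<longrightarrow> (\<forall>\<theta>\<in>J2 a2. best_underapprox2 \<theta> (2, a2)))
    \<and> J2 6 = {2/3 <.. 7/10} \<and> J2 12 = {7/12 <.. 13/22} \<and> J2 30 = {8/15 <.. 31/58}
    \<and> (\<forall>\<theta>\<in>J2 6. \<forall>p. best_underapprox2 \<theta> p \<longleftrightarrow> p = (2, 6) \<or> p = (3, 3))
    \<and> (\<forall>\<theta>\<in>J2 12. \<forall>p. best_underapprox2 \<theta> p \<longleftrightarrow> p = (2, 12) \<or> p = (3, 4))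
    \<and> (\<forall>\<theta>\<in>J2 30. \<forall>p. best_underapprox2 \<theta> p \<longleftrightarrow> p = (2, 30) \<or> p = (3, 5))
    \<and> (\<forall>\<theta>::real. 1/2 < \<theta> \<and> \<theta> \<le> 1 \<and> \<theta> \<notin> J2 6 \<union> J2 12 \<union> J2 30
          \<longrightarrow> unique_best_underapprox2 \<theta> (greedy2 \<theta>))"
proof (intro conjI)
  show "\<forall>a2::int. a2 \<ge> 3 \<longrightarrow> (\<forall>\<theta>\<in>J2 a2. best_underapprox2 \<theta> (2, a2))"
    by (simp add: best_underapprox2_J2_iff half_excess_pair_def)
  show "J2 6 = {2/3 <.. 7/10}" "J2 12 = {7/12 <.. 13/22}" "J2 30 = {8/15 <.. 31/58}"
    by (simp_all add: J2_def)
  show "\<forall>\<theta>\<in>J2 6. \<forall>p. best_underapprox2 \<theta> p \<longleftrightarrow> p = (2, 6) \<or> p = (3, 3)"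
    "\<forall>\<theta>\<in>J2 12. \<forall>p. best_underapprox2 \<theta> p \<longleftrightarrow> p = (2, 12) \<or> p = (3, 4)"
    "\<forall>\<theta>\<in>J2 30. \<forall>p. best_underapprox2 \<theta> p \<longleftrightarrow> p = (2, 30) \<or> p = (3, 5)"
    by (simp_all add: best_underapprox2_J2_iff[of 6] best_underapprox2_J2_iff[of 12]
        best_underapprox2_J2_iff[of 30] half_excess_pair_def)
  show "\<forall>\<theta>::real. 1/2 < \<theta> \<and> \<theta> \<le> 1 \<and> \<theta> \<notin> J2 6 \<union> J2 12 \<union> J2 30
          \<longrightarrow> unique_best_underapprox2 \<theta> (greedy2 \<theta>)"
  proof (intro allI impI)
    fix \<theta> :: real
    assume \<theta>: "1/2 < \<theta> \<and> \<theta> \<le> 1 \<and> \<theta> \<notin> J2 6 \<union> J2 12 \<union> J2 30"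
    then obtain a where a: "a \<ge> 3" "\<theta> \<in> J2 a" "greedy2 \<theta> = (2, a)"
      using greedy2_J2 by blast
    \<comment> \<open>Away from these three values, \<open>half_excess_pair a\<close> holds of (2,
      a) alone, which gives uniqueness.\<close>
    with \<theta> have "a \<noteq> 6" "a \<noteq> 12" "a \<noteq> 30" by auto
    with a show "unique_best_underapprox2 \<theta> (greedy2 \<theta>)"
      by (simp add: unique_best_underapprox2_def best_underapprox2_J2_iff half_excess_pair_def)
  qed
qed

end
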